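(* Let $\mathbb{X}\subseteq\mathbb{R}$ be a time scale that is unbounded above, let $t_0\in\mathbb{X}$, and assume $\sigma(\rho(t))=\rho(\sigma(t))=t$ for all $t\in[t_0,\infty)_{\mathbb{X}}=[t_0,\infty)\cap\mathbb{X}$. Let $A=\begin{pmatrix} A_1 & 0 \\ 0 & A_2 \end{pmatrix}\ge 0$ be a Hermitian $\mathbb{C}^{2n,2n}$-valued function on $[t_0,\infty)_{\mathbb{X}}$ with rd-continuous $n\times n$ blocks $A_1,A_2$, and let $\mathbb{D}$ be the space of $y=(y_1,y_2)^{\mathrm T}\in L_A^2(t_0,\infty)_{\mathbb{X}}$ such that $y_1,y_2^\rho:[t_0,\infty)_{\mathbb{X}}\to\mathbb{C}^n$ are delta differentiable. Let $J=\begin{pmatrix} 0_n & -I_n \\ I_n & 0_n \end{pmatrix}$. Then for all $y,z\in\mathbb{D}$ and all $a,b\in[t_0,\infty)_{\mathbb{X}}$ with $b>a$, $$\int_a^b\left[z^*J\widehat{y}^{\Delta}-\big(J\widehat{z}^{\Delta}\big)^*y\right](t)\,\Delta t=\widehat{z}^*(b)J\widehat{y}(b)-\widehat{z}^*(a)J\widehat{y}(a).$$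
   Context: A time scale $\mathbb{X}$ is a nonempty closed subset of $\mathbb{R}$. The jump operators are $\rho(t)=\sup\{s\in\mathbb{X}:s<t\}$ and $\sigma(t)=\inf\{s\in\mathbb{X}:s>t\}$ (with $\sup\emptyset=\inf\mathbb{X}$), and $\mu(t)=\sigma(t)-t$. Superscripts $\rho,\sigma$ denote composition with $\rho,\sigma$. The delta derivative is $y^\Delta(t)=\lim_{s\to t}\frac{y(\sigma(t))-y(s)}{\sigma(t)-s}$ (so $y^\Delta(t)=(y(\sigma(t))-y(t))/\mu(t)$ at a right-scattered point). The delta integral $\int_a^b g(t)\Delta t$ is the time-scale (Cauchy) integral: if $G^\Delta=g$ on $[a,b)\cap\mathbb{X}$ then $\int_a^b g\,\Delta t=G(b)-G(a)$. $L_A^2(t_0,\infty)_{\mathbb{X}}$ is the space of measurable $\mathbb{C}^{2n}$-valued $y$ with $\int_{t_0}^\infty y^*(t)A(t)y(t)\Delta t<\infty$. For $y=(y_1,y_2)^{\mathrm T}$ with $y_1$ defined on $[t_0,\infty)_{\mathbb{X}}$ and $y_2$ on $[\rho(t_0),\infty)_{\mathbb{X}}$, both $\mathbb{C}^n$-valued, $\widehat{y}(t)=\begin{pmatrix} y_1(t) \\ y_2(\rho(t)) \end{pmatrix}$. Superscript $*$ is the conjugate transpose. *)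

theory Defs
  imports "HOL-Analysis.Analysis"
begin

section \<open>Time scales\<close>

definition time_scale :: "real set \<Rightarrow> bool" where
  "time_scale T \<longleftrightarrow> T \<noteq> {} \<and> closed T"

definition fwd_jump :: "real set \<Rightarrow> real \<Rightarrow> real" where
  "fwd_jump T t = (if {s \<in> T. t < s} = {} then Sup T else Inf {s \<in> T. t < s})"

definition bwd_jump :: "real set \<Rightarrow> real \<Rightarrow> real" where
  "bwd_jump T t = (if {s \<in> T. s < t} = {} then Inf T else Sup {s \<in> T. s < t})"

text \<open>The filter along which \<open>s\<close> tends to \<open>t\<close> in the difference quotient of the delta derivative:
  \<open>s\<close> ranges over the points of \<open>T\<close> near \<open>t\<close> with \<open>s \<noteq> \<sigma>(t)\<close>. The point \<open>s = t\<close> itself is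
  admitted when \<open>t\<close> is right-scattered, so that there the limit is \<open>(f(\<sigma>(t)) - f(t)) / \<mu>(t)\<close>
  (and \<open>f\<close> has to be continuous at \<open>t\<close>), even if \<open>t\<close> is isolated.\<close>

definition delta_filter :: "real set \<Rightarrow> real \<Rightarrow> real filter" where
  "delta_filter T t = inf (nhds t) (principal (T - {fwd_jump T t}))"

definition delta_quotient :: "real set \<Rightarrow> (real \<Rightarrow> 'a::real_normed_vector) \<Rightarrow> real \<Rightarrow> real \<Rightarrow> 'a" where
  "delta_quotient T f t s = (f (fwd_jump T t) - f s) /\<^sub>R (fwd_jump T t - s)"

definition has_delta_derivative ::
  "real set \<Rightarrow> (real \<Rightarrow> 'a::real_normed_vector) \<Rightarrow> 'a \<Rightarrow> real \<Rightarrow> bool" where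
  "has_delta_derivative T f D t \<longleftrightarrow> (delta_quotient T f t \<longlongrightarrow> D) (delta_filter T t)"

definition delta_differentiable ::
  "real set \<Rightarrow> (real \<Rightarrow> 'a::real_normed_vector) \<Rightarrow> real \<Rightarrow> bool" where
  "delta_differentiable T f t \<longleftrightarrow> (\<exists>D. has_delta_derivative T f D t)"

definition delta_deriv :: "real set \<Rightarrow> (real \<Rightarrow> 'a::real_normed_vector) \<Rightarrow> real \<Rightarrow> 'a" where
  "delta_deriv T f t = Lim (delta_filter T t) (delta_quotient T f t)"

definition rd_continuous :: "real set \<Rightarrow> (real \<Rightarrow> 'a::topological_space) \<Rightarrow> bool" where
  "rd_continuous T f \<longleftrightarrow>
     (\<forall>t\<in>T. (fwd_jump T t = t \<longrightarrow> continuous (at t within T) f) \<and>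
            (bwd_jump T t = t \<longrightarrow> (\<exists>l. (f \<longlongrightarrow> l) (at t within T \<inter> {..<t}))))"

text \<open>The Cauchy integral over \<open>[a,b)\<close> via a delta antiderivative. Continuity of \<open>G\<close> on
  \<open>[a,b]\<close> only adds continuity at \<open>b\<close>; without it \<open>G(b)\<close> would be arbitrary for left-dense \<open>b\<close>.\<close>

definition has_delta_integral ::
  "real set \<Rightarrow> (real \<Rightarrow> 'a::real_normed_vector) \<Rightarrow> 'a \<Rightarrow> real \<Rightarrow> real \<Rightarrow> bool" where
  "has_delta_integral T g I a b \<longleftrightarrow>
     (\<exists>G. continuous_on (T \<inter> {a..b}) G \<and>
          (\<forall>t \<in> T \<inter> {a..<b}. has_delta_derivative T G (g t) t) \<and>
          I = G b - G a)"

definition delta_integrable ::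
  "real set \<Rightarrow> (real \<Rightarrow> 'a::real_normed_vector) \<Rightarrow> real \<Rightarrow> real \<Rightarrow> bool" where
  "delta_integrable T g a b \<longleftrightarrow> (\<exists>I. has_delta_integral T g I a b)"

definition delta_integral ::
  "real set \<Rightarrow> (real \<Rightarrow> 'a::real_normed_vector) \<Rightarrow> real \<Rightarrow> real \<Rightarrow> 'a" where
  "delta_integral T g a b = (THE I. has_delta_integral T g I a b)"

text \<open>The Lebesgue delta measure: the completion of the Borel measure on \<open>T\<close> determined by
  \<open>[a,b) \<inter> T \<mapsto> b - a\<close> for \<open>a, b \<in> T\<close> (for \<open>T\<close> unbounded above these sets generate the
  Borel sets of \<open>T\<close>).\<close>

definition delta_borel_measure :: "real set \<Rightarrow> real measure" where
  "delta_borel_measure T =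
     extend_measure T {(a, b). a \<in> T \<and> b \<in> T \<and> a \<le> b}
       (\<lambda>(a, b). T \<inter> {a..<b}) (\<lambda>(a, b). ennreal (b - a))"

definition delta_measure :: "real set \<Rightarrow> real measure" where
  "delta_measure T = completion (delta_borel_measure T)"


section \<open>Complex vectors and matrices\<close>

definition ctranspose :: "complex^'n::finite^'m::finite \<Rightarrow> complex^'m^'n" where
  "ctranspose M = (\<chi> i j. cnj (M $ j $ i))"

text \<open>\<open>cdot u v\<close> is the scalar \<open>u\<^sup>* v\<close>.\<close>

definition cdot :: "complex^'n::finite \<Rightarrow> complex^'n \<Rightarrow> complex" where
  "cdot u v = (\<Sum>i\<in>UNIV. cnj (u $ i) * v $ i)"

text \<open>For Hermitian \<open>M\<close> the number \<open>v\<^sup>* M v\<close> is real, so \<open>Re\<close> loses nothing.\<close>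

definition hermitian_psd :: "complex^'n::finite^'n \<Rightarrow> bool" where
  "hermitian_psd M \<longleftrightarrow> ctranspose M = M \<and> (\<forall>v. 0 \<le> Re (cdot v (M *v v)))"

text \<open>\<open>\<complex>\<^sup>2\<^sup>n\<close> is \<open>complex^('n + 'n)\<close>; the two summands index the upper and the lower half.\<close>

definition upper :: "complex^('n::finite + 'n) \<Rightarrow> complex^'n" where
  "upper v = (\<chi> i. v $ Inl i)"

definition lower :: "complex^('n::finite + 'n) \<Rightarrow> complex^'n" where
  "lower v = (\<chi> i. v $ Inr i)"

definition stack :: "complex^'n::finite \<Rightarrow> complex^'n \<Rightarrow> complex^('n + 'n)" where
  "stack u v = (\<chi> i. case i of Inl k \<Rightarrow> u $ k | Inr k \<Rightarrow> v $ k)"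

definition block_matrix ::
  "complex^'n::finite^'n \<Rightarrow> complex^'n^'n \<Rightarrow> complex^'n^'n \<Rightarrow> complex^'n^'n \<Rightarrow> complex^('n + 'n)^('n + 'n)" where
  "block_matrix P Q R S = (\<chi> i. case i of Inl k \<Rightarrow> stack (P $ k) (Q $ k)
                                        | Inr k \<Rightarrow> stack (R $ k) (S $ k))"

definition J_matrix :: "complex^('n::finite + 'n)^('n + 'n)" where
  "J_matrix = block_matrix 0 (- mat 1) (mat 1) 0"


section \<open>The function spaces\<close>

text \<open>Only the values of \<open>upper \<circ> y\<close> on \<open>[t\<^sub>0,\<infinity>)\<close> and of \<open>lower \<circ> y\<close> on \<open>[\<rho>(t\<^sub>0),\<infinity>)\<close>
  matter below. The jump \<open>\<rho>\<close> is that of the whole time scale \<open>X\<close>, while delta derivatives, integrals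
  and the measure are those of \<open>[t\<^sub>0,\<infinity>) \<inter> X\<close>, the domain of the functions involved (for a
  left-dense \<open>t\<^sub>0\<close> the derivative at \<open>t\<^sub>0\<close> must not see points to the left of \<open>t\<^sub>0\<close>).\<close>

definition hat :: "real set \<Rightarrow> (real \<Rightarrow> complex^('n::finite + 'n)) \<Rightarrow> real \<Rightarrow> complex^('n + 'n)" where
  "hat X y t = stack (upper (y t)) (lower (y (bwd_jump X t)))"

text \<open>Functions are not identified modulo \<open>A\<close>-null functions.\<close>

definition L2_space ::
  "real set \<Rightarrow> (real \<Rightarrow> complex^'m::finite^'m) \<Rightarrow> (real \<Rightarrow> complex^'m) set" where
  "L2_space T A = {y. y \<in> borel_measurable (delta_measure T) \<and>
     (\<integral>\<^sup>+ t. ennreal (Re (cdot (y t) (A t *v y t))) \<partial>delta_measure T) < \<infinity>}"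

definition D_space ::
  "real set \<Rightarrow> real \<Rightarrow> (real \<Rightarrow> complex^('n::finite + 'n)^('n + 'n)) \<Rightarrow> (real \<Rightarrow> complex^('n + 'n)) set" where
  "D_space X t0 A = {y \<in> L2_space (X \<inter> {t0..}) A.
     \<forall>t \<in> X \<inter> {t0..}.
       delta_differentiable (X \<inter> {t0..}) (\<lambda>s. upper (y s)) t \<and>
       delta_differentiable (X \<inter> {t0..}) (\<lambda>s. lower (y (bwd_jump X s))) t}"


section \<open>Well-definedness of derivative, integral and measure\<close>

lemma fwd_jump_props:
  assumes T: "time_scale T" and b: "b \<in> T" "t < b"
  shows "fwd_jump T t \<in> T" "t \<le> fwd_jump T t" "fwd_jump T t \<le> b"
    "\<And>s. s \<in> T \<Longrightarrow> t < s \<Longrightarrow> fwd_jump T t \<le> s"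
proof -
  let ?S = "{s \<in> T. t < s}"
  have ne: "?S \<noteq> {}" using b by auto
  have bdd: "bdd_below ?S" by (auto intro!: bdd_belowI[of _ t])
  have eq: "fwd_jump T t = Inf ?S" using ne by (auto simp: fwd_jump_def)
  have "Inf ?S \<in> closure ?S" using closure_contains_Inf[OF ne bdd] .
  also have "closure ?S \<subseteq> T"
    using T by (intro closure_minimal) (auto simp: time_scale_def)
  finally show "fwd_jump T t \<in> T" unfolding eq .
  show "t \<le> fwd_jump T t" unfolding eq by (rule cInf_greatest[OF ne]) auto
  show le: "fwd_jump T t \<le> s" if "s \<in> T" "t < s" for s
    unfolding eq by (rule cInf_lower[OF _ bdd]) (use that in auto)
  show "fwd_jump T t \<le> b" by (rule le) (use b in auto)
qed

lemma right_dense_point: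
  assumes T: "time_scale T" and b: "b \<in> T" "t < b" and rd: "fwd_jump T t = t" and e: "e > 0"
  obtains s where "s \<in> T" "t < s" "s < t + e" "s \<le> b"
proof -
  let ?S = "{s \<in> T. t < s}"
  have ne: "?S \<noteq> {}" using b by auto
  then have "Inf ?S = t" using rd unfolding fwd_jump_def by (metis (lifting))
  then have "Inf ?S < t + e" using e by simp
  then obtain s where s: "s \<in> ?S" "s < t + e"
    using cInf_lessD[OF ne] by blast
  show ?thesis
    by (cases "s \<le> b") (use s b that[of s] that[of b] in auto)
qed

lemma delta_filter_neq_bot:
  assumes T: "time_scale T" and t: "t \<in> T" and b: "b \<in> T" "t < b"
  shows "delta_filter T t \<noteq> bot"
proof
  assume "delta_filter T t = bot"
  then have "eventually (\<lambda>_. False) (delta_filter T t)" by simp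
  then obtain d where d: "d > 0" "\<And>s. dist s t < d \<Longrightarrow> s \<in> T - {fwd_jump T t} \<Longrightarrow> False"
    unfolding delta_filter_def eventually_inf_principal eventually_nhds_metric by blast
  show False
  proof (cases "fwd_jump T t = t")
    case True
    obtain s where "s \<in> T" "t < s" "s < t + d" "s \<le> b"
      using right_dense_point[OF T b True d(1)] .
    then show False using d(2)[of s] True by (auto simp: dist_real_def)
  next
    case False
    then show False using d(1) d(2)[of t] t by simp
  qed
qed

lemma delta_deriv_eq:
  assumes "time_scale T" "t \<in> T" "b \<in> T" "t < b" "has_delta_derivative T f D t"
  shows "delta_deriv T f t = D"
  using tendsto_Lim[OF delta_filter_neq_bot[OF assms(1-4)]] assms(5)
  unfolding delta_deriv_def has_delta_derivative_def by blast

lemma delta_derivative_zero_imp_const: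
  fixes H :: "real \<Rightarrow> 'a::real_normed_vector"
  assumes T: "time_scale T" and ab: "a \<in> T" "b \<in> T" "a \<le> b"
    and cont: "continuous_on (T \<inter> {a..b}) H"
    and der: "\<And>t. t \<in> T \<inter> {a..<b} \<Longrightarrow> has_delta_derivative T H 0 t"
  shows "H b = H a"
proof -
  have bound: "norm (H b - H a) \<le> e * (b - a)" if e: "e > 0" for e
  proof -
    define K where "K = {t \<in> T \<inter> {a..b}. norm (H t - H a) \<le> e * (t - a)}"
    define W where "W = {t \<in> T \<inter> {a..b}. T \<inter> {a..t} \<subseteq> K}"
    have clT: "closed (T \<inter> {a..b})" using T by (auto simp: time_scale_def)
    have "closed K" unfolding K_def
      by (rule continuous_on_closed_Collect_le[OF _ _ clT]) (intro continuous_intros cont)+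
    have WK: "W \<subseteq> K" by (auto simp: W_def)
    have aW: "a \<in> W" using ab by (auto simp: W_def K_def)
    have bdd: "bdd_above W" by (rule bdd_aboveI[of _ b]) (auto simp: W_def)
    define c where "c = Sup W"
    have "c \<in> closure W"
      unfolding c_def by (rule closure_contains_Sup) (use aW bdd in auto)
    then have cK: "c \<in> K"
      using closure_minimal[OF WK \<open>closed K\<close>] by blast
    have cW: "c \<in> W"
    proof -
      have "s \<in> K" if s: "s \<in> T" "a \<le> s" "s \<le> c" for s
      proof (cases "s = c")
        case True then show ?thesis using cK by simp
      next
        case False
        then have "s < Sup W" using s by (simp add: c_def)
        then obtain w where "w \<in> W" "s < w" using less_cSupD[of W s] aW by blast
        then show ?thesis using s by (auto simp: W_def)
      qed
      then show ?thesis using cK by (auto simp: W_def K_def)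
    qed
    have top: "w \<le> c" if "w \<in> W" for w
      unfolding c_def using that bdd by (rule cSup_upper)
    have "c = b"
    proof (rule ccontr)
      assume "c \<noteq> b"
      then have c: "c \<in> T" "a \<le> c" "c < b" using cK by (auto simp: K_def)
      let ?s = "fwd_jump T c"
      note fj = fwd_jump_props[OF T ab(2) c(3)]
      have "(delta_quotient T H c \<longlongrightarrow> 0) (delta_filter T c)"
        using der[of c] c by (auto simp: has_delta_derivative_def)
      then have "eventually (\<lambda>s. norm (delta_quotient T H c s) < e) (delta_filter T c)"
        using e by (auto simp: tendsto_iff dist_norm)
      then obtain d where d: "d > 0"
        "\<And>s. dist s c < d \<Longrightarrow> s \<in> T - {?s} \<Longrightarrow> norm (delta_quotient T H c s) < e"
        unfolding delta_filter_def eventually_inf_principal eventually_nhds_metric by blast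
      have step: "norm (H ?s - H s) \<le> e * \<bar>?s - s\<bar>" if "dist s c < d" "s \<in> T" for s
      proof (cases "s = ?s")
        case False
        then have "norm (H ?s - H s) / \<bar>?s - s\<bar> < e"
          using d(2)[of s] that by (auto simp: delta_quotient_def divide_inverse mult.commute)
        then show ?thesis using False by (simp add: divide_less_eq)
      qed simp
      have extend: "s \<in> K"
        if "s \<in> T" "s \<le> b" "c \<le> s" "norm (H s - H c) \<le> e * (s - c)" for s
      proof -
        have "norm (H s - H a) \<le> norm (H s - H c) + norm (H c - H a)"
          by (metis diff_add_cancel add_diff_eq norm_triangle_ineq)
        also have "\<dots> \<le> e * (s - c) + e * (c - a)"
          using that cK by (intro add_mono) (auto simp: K_def)
        also have "\<dots> = e * (s - a)" by (simp add: algebra_simps)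
        finally show ?thesis using that c by (auto simp: K_def)
      qed
      have "\<exists>w\<in>W. c < w"
      proof (cases "?s = c")
        case True
        obtain w where w: "w \<in> T" "c < w" "w < c + d" "w \<le> b"
          using right_dense_point[OF T ab(2) c(3) True d(1)] .
        have "s \<in> K" if s: "s \<in> T" "a \<le> s" "s \<le> w" for s
        proof (cases "s \<le> c")
          case True then show ?thesis using cW s by (auto simp: W_def)
        next
          case False
          then show ?thesis
            using step[of s] s w True
            by (intro extend) (auto simp: dist_real_def norm_minus_commute)
        qed
        then have "w \<in> W" using w c by (auto simp: W_def)
        then show ?thesis using w by blast
      next
        case False
        then have lt: "c < ?s" using fj by simp
        have "s \<in> K" if s: "s \<in> T" "a \<le> s" "s \<le> ?s" for s
        proof (cases "s \<le> c")
          case True then show ?thesis using cW s by (auto simp: W_def)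
        next
          case False
          then have "s = ?s" using fj(4)[of s] s by simp
          then show ?thesis
            using step[of c] c fj lt d(1) by (intro extend) auto
        qed
        then have "?s \<in> W" using fj c by (auto simp: W_def)
        then show ?thesis using lt by blast
      qed
      then show False using top by force
    qed
    then show ?thesis using cK by (auto simp: K_def)
  qed
  have "norm (H b - H a) \<le> 0"
  proof (cases "a = b")
    case False
    then have "b - a > 0" using ab by simp
    show ?thesis
    proof (rule field_le_epsilon)
      fix e :: real assume "e > 0"
      then show "norm (H b - H a) \<le> 0 + e"
        using bound[of "e / (b - a)"] \<open>b - a > 0\<close> by simp
    qed
  qed simp
  then show ?thesis by simp
qed

lemma has_delta_integral_unique:
  assumes T: "time_scale T" and ab: "a \<in> T" "b \<in> T" "a \<le> b"
    and "has_delta_integral T g I a b" "has_delta_integral T g I' a b"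
  shows "I = I'"
proof -
  obtain F where F: "continuous_on (T \<inter> {a..b}) F"
    "\<And>t. t \<in> T \<inter> {a..<b} \<Longrightarrow> has_delta_derivative T F (g t) t" "I = F b - F a"
    using assms(5) by (auto simp: has_delta_integral_def)
  obtain G where G: "continuous_on (T \<inter> {a..b}) G"
    "\<And>t. t \<in> T \<inter> {a..<b} \<Longrightarrow> has_delta_derivative T G (g t) t" "I' = G b - G a"
    using assms(6) by (auto simp: has_delta_integral_def)
  have "has_delta_derivative T (\<lambda>s. F s - G s) 0 t" if t: "t \<in> T \<inter> {a..<b}" for t
  proof -
    have "((\<lambda>s. delta_quotient T F t s - delta_quotient T G t s) \<longlongrightarrow> g t - g t) (delta_filter T t)"
      using F(2)[OF t] G(2)[OF t] unfolding has_delta_derivative_def by (rule tendsto_diff)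
    moreover have "(\<lambda>s. delta_quotient T F t s - delta_quotient T G t s)
        = delta_quotient T (\<lambda>s. F s - G s) t"
      by (auto simp: delta_quotient_def fun_eq_iff algebra_simps)
    ultimately show ?thesis by (simp add: has_delta_derivative_def)
  qed
  from delta_derivative_zero_imp_const[OF T ab continuous_on_diff[OF F(1) G(1)] this]
  have "F b - G b = F a - G a" .
  then show ?thesis unfolding F(3) G(3) by (simp add: algebra_simps)
qed

lemma delta_integral_eq:
  assumes "time_scale T" "a \<in> T" "b \<in> T" "a \<le> b" "has_delta_integral T g I a b"
  shows "delta_integral T g a b = I"
  unfolding delta_integral_def
  by (rule the_equality) (use assms has_delta_integral_unique in blast)+

text \<open>\<open>extend_measure\<close> is not vacuous here: the push-forward of Lebesgue measure under
  \<open>s \<mapsto> sup {t \<in> T. t \<le> s}\<close> has the required values.\<close>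

lemma emeasure_delta_borel_measure:
  assumes T: "time_scale T" and ab: "a \<in> T" "b \<in> T" "a \<le> b"
  shows "emeasure (delta_borel_measure T) (T \<inter> {a..<b}) = ennreal (b - a)"
proof -
  define N where "N = {s. \<exists>t\<in>T. t \<le> s}"
  define p where "p s = Sup {t \<in> T. t \<le> s}" for s
  have p: "p s \<in> T" "p s \<le> s" "\<And>t. t \<in> T \<Longrightarrow> t \<le> s \<Longrightarrow> t \<le> p s" if s: "s \<in> N" for s
  proof -
    have ne: "{t \<in> T. t \<le> s} \<noteq> {}" using s by (auto simp: N_def)
    have bdd: "bdd_above {t \<in> T. t \<le> s}" by (auto intro!: bdd_aboveI[of _ s])
    have "p s \<in> closure {t \<in> T. t \<le> s}"
      unfolding p_def by (rule closure_contains_Sup[OF ne bdd])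
    moreover have "closure {t \<in> T. t \<le> s} \<subseteq> T"
      using T by (intro closure_minimal) (auto simp: time_scale_def)
    ultimately show "p s \<in> T" by blast
    show "p s \<le> s" unfolding p_def by (rule cSup_least[OF ne]) auto
    show "t \<le> p s" if "t \<in> T" "t \<le> s" for t
      unfolding p_def by (rule cSup_upper[OF _ bdd]) (use that in auto)
  qed
  have N: "N \<in> sets lborel"
  proof (cases "bdd_below T")
    case True
    have "Inf T \<in> T"
      using T True closed_contains_Inf by (auto simp: time_scale_def)
    then have "N = {Inf T..}"
      using cInf_lower[OF _ True] by (force simp: N_def)
    then show ?thesis by simp
  next
    case False
    have "N = UNIV"
    proof (rule set_eqI)
      fix s
      show "s \<in> N \<longleftrightarrow> s \<in> UNIV"
        using False bdd_belowI[of T s] unfolding N_def by force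
    qed
    then show ?thesis by simp
  qed
  have pre: "p -` (T \<inter> {x..<y}) \<inter> N = {x..<y}" if "x \<in> T" "y \<in> T" for x y
  proof (intro set_eqI iffI)
    fix s assume s: "s \<in> p -` (T \<inter> {x..<y}) \<inter> N"
    then have "x \<le> p s" "p s < y" "p s \<le> s" using p(2)[of s] by auto
    moreover have "y \<le> p s" if "y \<le> s" using p(3)[of s y] s that \<open>y \<in> T\<close> by auto
    ultimately show "s \<in> {x..<y}" by force
  next
    fix s assume s: "s \<in> {x..<y}"
    then have sN: "s \<in> N" using that by (auto simp: N_def)
    then show "s \<in> p -` (T \<inter> {x..<y}) \<inter> N"
      using p[OF sN] s that by force
  qed
  let ?I = "{(x, y). x \<in> T \<and> y \<in> T \<and> x \<le> y}"
  let ?G = "\<lambda>(x, y). T \<inter> {x..<y :: real}"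
  have pow: "?G ` ?I \<subseteq> Pow T" by auto
  have sets: "sets (delta_borel_measure T) = sigma_sets T (?G ` ?I)"
    unfolding delta_borel_measure_def by (rule sets_extend_measure[OF pow])
  let ?L = "restrict_space lborel N"
  have meas: "p \<in> measurable ?L (delta_borel_measure T)"
  proof (rule measurable_sigma_sets[OF sets pow])
    show "p \<in> space ?L \<rightarrow> T" using p(1) by (auto simp: space_restrict_space)
    fix B assume "B \<in> ?G ` ?I"
    then obtain x y where xy: "x \<in> T" "y \<in> T" "B = T \<inter> {x..<y}" by auto
    then have "p -` B \<inter> space ?L = {x..<y}"
      using pre[of x y] by (simp add: space_restrict_space)
    moreover have "{x..<y} \<subseteq> N" using pre[of x y] xy by blast
    ultimately show "p -` B \<inter> space ?L \<in> sets ?L"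
      using N by (simp add: sets_restrict_space_iff)
  qed
  let ?\<mu> = "emeasure (distr ?L (delta_borel_measure T) p)"
  have val: "?\<mu> (?G i) = (\<lambda>(x, y). ennreal (y - x)) i" if "i \<in> ?I" for i
  proof -
    obtain x y where xy: "i = (x, y)" "x \<in> T" "y \<in> T" "x \<le> y" using \<open>i \<in> ?I\<close> by auto
    have "T \<inter> {x..<y} \<in> sets (delta_borel_measure T)"
      unfolding sets by (rule sigma_sets.Basic) (use xy in auto)
    then have "?\<mu> (T \<inter> {x..<y}) = emeasure ?L {x..<y}"
      using pre[of x y] xy by (simp add: emeasure_distr[OF meas] space_restrict_space)
    also have "\<dots> = emeasure lborel {x..<y}"
      by (rule emeasure_restrict_space) (use N pre[of x y] xy in auto)
    finally show ?thesis using xy by simp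
  qed
  have "emeasure (delta_borel_measure T) (?G (a, b)) = (\<lambda>(x, y). ennreal (y - x)) (a, b)"
  proof (rule emeasure_extend_measure[OF delta_borel_measure_def val pow])
    show "positive (sets (delta_borel_measure T)) ?\<mu>"
      by (metis emeasure_positive sets_distr)
    show "countably_additive (sets (delta_borel_measure T)) ?\<mu>"
      by (metis emeasure_countably_additive sets_distr)
  qed (use ab in auto)
  then show ?thesis by simp
qed

end

theory Submission
  imports Defs
begin

text \<open>Since \<open>u\<^sup>* J v = u\<^sub>2\<^sup>* v\<^sub>1 - u\<^sub>1\<^sup>* v\<^sub>2\<close>, the product rule makes
  \<open>(hat z)\<^sup>* J (hat y) = (z\<^sub>2\<^sup>\<rho>)\<^sup>* y\<^sub>1 - z\<^sub>1\<^sup>* y\<^sub>2\<^sup>\<rho>\<close> a delta antiderivative of the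
  integrand: in each product the rule is used in the form that evaluates the \<open>\<rho>\<close>-shifted factor
  at \<open>\<sigma>(t)\<close>, where \<open>\<rho>(\<sigma>(t)) = t\<close> undoes the shift.\<close>

text \<open>Solving the quotient for \<open>f s\<close> gives
  \<open>f s = f \<sigma> - (\<sigma> - s) q(s)\<close> with \<open>\<sigma> = fwd_jump T t\<close>,
  so \<open>f\<close> tends to \<open>f \<sigma> - (\<sigma> - t) D\<close>. This is
  \<open>f t\<close> trivially for right-dense \<open>t\<close>.\<close>

lemma has_delta_derivative_imp_tendsto:
  fixes f :: "real \<Rightarrow> 'a::real_normed_vector"
  assumes t: "t \<in> T" and f: "has_delta_derivative T f D t"
  shows "(f \<longlongrightarrow> f t) (delta_filter T t)"
proof -
  let ?s = "fwd_jump T t"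
  have q: "(delta_quotient T f t \<longlongrightarrow> D) (delta_filter T t)"
    using f by (simp add: has_delta_derivative_def)
  have id: "((\<lambda>s. s) \<longlongrightarrow> t) (delta_filter T t)"
    unfolding delta_filter_def filterlim_def by simp
  have "((\<lambda>s. f ?s - (?s - s) *\<^sub>R delta_quotient T f t s) \<longlongrightarrow> f ?s - (?s - t) *\<^sub>R D)
      (delta_filter T t)"
    by (intro tendsto_intros q id)
  moreover have "f ?s - (?s - t) *\<^sub>R D = f t"
  proof (cases "?s = t")
    case False
    \<comment> \<open>At a right-scattered point the filter admits \<open>s = t\<close> itself, so
      the limit \<open>D\<close> must be the quotient at \<open>t\<close>.\<close>
    have "principal {t} \<le> delta_filter T t"
      using t False by (auto simp: delta_filter_def le_filter_def eventually_inf_principal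
          eventually_principal dest: eventually_nhds_x_imp_x)
    then have "(delta_quotient T f t \<longlongrightarrow> D) (principal {t})"
      using q tendsto_mono by blast
    then have "delta_quotient T f t t = D"
      by (intro tendsto_unique[OF _ tendsto_principal_singleton]) (auto simp: principal_eq_bot_iff)
    then show ?thesis using False by (auto simp: delta_quotient_def)
  qed simp
  moreover have "\<forall>\<^sub>F s in delta_filter T t. f ?s - (?s - s) *\<^sub>R delta_quotient T f t s = f s"
    by (auto simp: delta_filter_def delta_quotient_def eventually_inf_principal)
  ultimately show ?thesis by (simp add: tendsto_cong)
qed

text \<open>Removing \<open>fwd_jump T t\<close> from \<open>T\<close> does not change the punctured
  filter at \<open>t\<close>, since that point is either \<open>t\<close> or at positive distance
  from it.\<close>

lemma has_delta_derivative_imp_continuous: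
  fixes f :: "real \<Rightarrow> 'a::real_normed_vector"
  assumes t: "t \<in> T" and f: "has_delta_derivative T f D t"
  shows "continuous (at t within T) f"
proof -
  let ?s = "fwd_jump T t"
  have "at t within T = at t within T - {?s}"
  proof (cases "?s = t")
    case True
    then show ?thesis by (simp add: at_within_def)
  next
    case False
    then show ?thesis by (intro at_within_nhd[of t "- {?s}"]) auto
  qed
  also have "\<dots> \<le> delta_filter T t"
    unfolding at_within_def delta_filter_def by (intro inf_mono) auto
  finally show ?thesis
    unfolding continuous_within
    using tendsto_mono has_delta_derivative_imp_tendsto[OF assms] by blast
qed

lemma has_delta_derivative_diff:
  assumes "has_delta_derivative T f D t" "has_delta_derivative T g E t"
  shows "has_delta_derivative T (\<lambda>s. f s - g s) (D - E) t"
proof -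
  have "delta_quotient T (\<lambda>s. f s - g s) t
      = (\<lambda>s. delta_quotient T f t s - delta_quotient T g t s)"
    by (auto simp: delta_quotient_def fun_eq_iff algebra_simps)
  then show ?thesis
    using assms by (simp add: has_delta_derivative_def tendsto_diff)
qed

text \<open>Product rule, by inserting the mixed term \<open>B (f \<sigma>) (g s)\<close> with
  \<open>\<sigma> = fwd_jump T t\<close>. The first factor ends up at \<open>\<sigma>\<close>, the
  second at \<open>t\<close>.\<close>

lemma has_delta_derivative_bilinear:
  assumes B: "bounded_bilinear B" and t: "t \<in> T"
    and f: "has_delta_derivative T f D t" and g: "has_delta_derivative T g E t"
  shows "has_delta_derivative T (\<lambda>s. B (f s) (g s)) (B (f (fwd_jump T t)) E + B D (g t)) t"
proof -
  interpret bounded_bilinear B by (rule B)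
  have "delta_quotient T (\<lambda>s. B (f s) (g s)) t
      = (\<lambda>s. B (f (fwd_jump T t)) (delta_quotient T g t s) + B (delta_quotient T f t s) (g s))"
    by (simp add: delta_quotient_def fun_eq_iff scaleR_left scaleR_right diff_left diff_right
        flip: scaleR_right_distrib)
  then show ?thesis
    using f g has_delta_derivative_imp_tendsto[OF t g]
    by (auto simp: has_delta_derivative_def intro!: tendsto_add tendsto)
qed

text \<open>Conjugate-linearity in the first argument is still real linearity, and real bilinear
  maps in finite dimension are bounded.\<close>

lemma bounded_bilinear_cdot: "bounded_bilinear (cdot :: complex^'n \<Rightarrow> complex^'n \<Rightarrow> complex)"
  by (subst bilinear_conv_bounded_bilinear[symmetric])
    (auto simp: bilinear_def linear_iff cdot_def algebra_simps sum.distrib scaleR_sum_right)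

lemma cdot_J_matrix:
  "cdot u (J_matrix *v v) = cdot (lower u) (upper v) - cdot (upper u) (lower v)"
  "cdot (J_matrix *v v) u = cdot (upper v) (lower u) - cdot (lower v) (upper u)"
proof -
  have S: "(\<Sum>i\<in>UNIV. f i) = (\<Sum>i\<in>UNIV. f (Inl i)) + (\<Sum>i\<in>UNIV. f (Inr i))"
    for f :: "'b::finite + 'b \<Rightarrow> complex"
    by (simp flip: UNIV_Plus_UNIV add: sum.Plus)
  have U: "(J_matrix *v v) $ Inl i = - v $ Inr i" and L: "(J_matrix *v v) $ Inr i = v $ Inl i" for i
    by (simp_all add: matrix_vector_mult_def S J_matrix_def block_matrix_def stack_def mat_def
        sum_negf if_distrib[of "\<lambda>x. x * _"] cong: if_cong)
  show "cdot u (J_matrix *v v) = cdot (lower u) (upper v) - cdot (upper u) (lower v)"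
    "cdot (J_matrix *v v) u = cdot (upper v) (lower u) - cdot (lower v) (upper u)"
    by (simp_all add: cdot_def S U L upper_def lower_def sum_negf)
qed

lemma upper_stack [simp]: "upper (stack u v) = u"
  and lower_stack [simp]: "lower (stack u v) = v"
  by (simp_all add: upper_def lower_def stack_def)

lemma has_delta_derivative_stack:
  assumes "has_delta_derivative T f D t" "has_delta_derivative T g E t"
  shows "has_delta_derivative T (\<lambda>s. stack (f s) (g s)) (stack D E) t"
proof -
  have "delta_quotient T (\<lambda>s. stack (f s) (g s)) t
      = (\<lambda>s. stack (delta_quotient T f t s) (delta_quotient T g t s))"
    by (auto simp: delta_quotient_def stack_def vec_eq_iff fun_eq_iff split: sum.split)
  then show ?thesis
    using assms unfolding has_delta_derivative_def
    by (auto simp: stack_def split: sum.split intro!: vec_tendstoI intro: tendsto_vec_nth)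
qed

theorem theorem2p2:
  fixes X :: "real set" and t0 a b :: real
    and A1 A2 :: "real \<Rightarrow> complex^'n^'n"
    and A :: "real \<Rightarrow> complex^('n + 'n)^('n + 'n)"
    and y z :: "real \<Rightarrow> complex^('n + 'n)"
  defines "T \<equiv> X \<inter> {t0..}"
  assumes "time_scale X" and "\<not> bdd_above X" and "t0 \<in> X"
    and "\<forall>t\<in>T. fwd_jump X (bwd_jump X t) = t \<and> bwd_jump X (fwd_jump X t) = t"
    and "\<forall>t\<in>T. A t = block_matrix (A1 t) 0 0 (A2 t)"
    and "\<forall>t\<in>T. hermitian_psd (A t)"
    and "rd_continuous T A1" and "rd_continuous T A2"
    and "y \<in> D_space X t0 A" and "z \<in> D_space X t0 A"
    and "a \<in> T" and "b \<in> T" and "a < b"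
  shows "delta_integrable T (\<lambda>t. cdot (z t) (J_matrix *v delta_deriv T (hat X y) t)
             - cdot (J_matrix *v delta_deriv T (hat X z) t) (y t)) a b \<and>
         delta_integral T (\<lambda>t. cdot (z t) (J_matrix *v delta_deriv T (hat X y) t)
             - cdot (J_matrix *v delta_deriv T (hat X z) t) (y t)) a b
         = cdot (hat X z b) (J_matrix *v hat X y b) - cdot (hat X z a) (J_matrix *v hat X y a)"
proof -
  \<comment> \<open>A later point makes the delta filter at \<open>t\<close> proper, which
    determines \<open>delta_deriv\<close>.\<close>
  have above: "\<exists>s\<in>T. t < s" if "t \<in> T" for t
    using \<open>\<not> bdd_above X\<close> that unfolding T_def bdd_above_def by (force simp: not_le)
  have T: "time_scale T"
    using \<open>time_scale X\<close> \<open>t0 \<in> X\<close> by (auto simp: T_def time_scale_def)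
  \<comment> \<open>The forward jump looks only to the right, so cutting \<open>X\<close> off below
    \<open>t0\<close> leaves it unchanged on \<open>T\<close>.\<close>
  have jump: "bwd_jump X (fwd_jump T t) = t" if t: "t \<in> T" for t
  proof -
    have "{s \<in> T. t < s} = {s \<in> X. t < s}" using t by (auto simp: T_def)
    then have "fwd_jump T t = fwd_jump X t"
      using above[OF t] by (auto simp: fwd_jump_def)
    then show ?thesis using assms(5) t by simp
  qed
  have diff: "has_delta_derivative T (\<lambda>s. upper (w s)) (upper (delta_deriv T (hat X w) t)) t \<and>
      has_delta_derivative T (\<lambda>s. lower (w (bwd_jump X s))) (lower (delta_deriv T (hat X w) t)) t"
    if t: "t \<in> T" and w: "w \<in> D_space X t0 A" for w t
  proof -
    obtain D E where DE: "has_delta_derivative T (\<lambda>s. upper (w s)) D t"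
      "has_delta_derivative T (\<lambda>s. lower (w (bwd_jump X s))) E t"
      using t w unfolding D_space_def T_def delta_differentiable_def by blast
    obtain s where s: "s \<in> T" "t < s" using above[OF t] by blast
    have "has_delta_derivative T (hat X w) (stack D E) t"
      unfolding hat_def[abs_def] by (rule has_delta_derivative_stack[OF DE])
    then have "delta_deriv T (hat X w) t = stack D E"
      by (rule delta_deriv_eq[OF T t s])
    then show ?thesis using DE by simp
  qed
  let ?g = "\<lambda>t. cdot (z t) (J_matrix *v delta_deriv T (hat X y) t)
             - cdot (J_matrix *v delta_deriv T (hat X z) t) (y t)"
  let ?G = "\<lambda>t. cdot (hat X z t) (J_matrix *v hat X y t)"
  have der: "has_delta_derivative T ?G (?g t) t" if t: "t \<in> T" for t
  proof -
    note y = diff[OF t \<open>y \<in> D_space X t0 A\<close>] and z = diff[OF t \<open>z \<in> D_space X t0 A\<close>]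
    note lower_upper = has_delta_derivative_bilinear[OF bounded_bilinear_cdot t
        z[THEN conjunct2] y[THEN conjunct1]]
    \<comment> \<open>The flip makes the shifted half of \<open>y\<close> the first factor, the one
      evaluated at \<open>\<sigma>(t)\<close>.\<close>
    note upper_lower = has_delta_derivative_bilinear[
        OF bounded_bilinear.flip[OF bounded_bilinear_cdot] t
        y[THEN conjunct2] z[THEN conjunct1]]
    show ?thesis
      using has_delta_derivative_diff[OF lower_upper upper_lower]
      by (simp add: cdot_J_matrix hat_def jump[OF t] algebra_simps)
  qed
  \<comment> \<open>The derivative exists on all of \<open>T\<close>, in particular at
    \<open>b\<close>, which gives continuity at the right endpoint.\<close>
  have "continuous_on (T \<inter> {a..b}) ?G"
    by (rule continuous_on_subset[of T])
      (auto simp: continuous_on_eq_continuous_within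
        intro: has_delta_derivative_imp_continuous[OF _ der])
  then have I: "has_delta_integral T ?g (?G b - ?G a) a b"
    unfolding has_delta_integral_def using der by blast
  then show ?thesis
    using delta_integral_eq[OF T \<open>a \<in> T\<close> \<open>b \<in> T\<close> less_imp_le[OF \<open>a < b\<close>] I]
    unfolding delta_integrable_def by blast
qed

end
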